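(* Let $d \geq 1$ and $k \geq 2$ be integers, let $q_k:=\log_2(2+2^k)$, and let $A,B \subseteq \{-1,1\}^d$. Then $$\widetilde{E}_k(A,B) \leq |A|^{q_k/2}\,|B|^{q_k/2}.$$ Furthermore, the exponent $q_k$ cannot be replaced by any smaller number; that is, for every real $q<q_k$ there exist $A,B\subseteq\{-1,1\}^d$ with $\widetilde{E}_k(A,B)>|A|^{q/2}|B|^{q/2}$.
   Context: For $A,B\subseteq\{-1,1\}^d$ and an integer $k\geq 2$, the $k$-higher additive energy of $A$ and $B$ is $$\widetilde{E}_{k}(A,B):=\big|\{(a_1,\dots,a_{k}, b_1, \dots, b_k) \in A^{k} \times B^k : a_1-b_1= a_2-b_2=\cdots = a_{k} - b_{k}\}\big|,$$ where the differences are taken in $\mathbb{Z}^d$, and $|\cdot|$ denotes cardinality. *)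

theory Defs
  imports "HOL-Analysis.Analysis"
begin

text \<open>
  The ambient group \<open>\<int>\<^sup>d\<close> is the type \<open>int ^ 'd\<close> with \<open>d = CARD('d)\<close>, so that the differences
  below are the library's componentwise integer subtraction.
\<close>

definition sign_cube :: "(int ^ 'd) set" where
  "sign_cube = {v. \<forall>i. v $ i \<in> {-1, 1}}"

text \<open>A \<open>k\<close>-tuple over \<open>A\<close> is an extensional function from \<open>{..<k}\<close> to \<open>A\<close>, so indices start at \<open>0\<close>.\<close>

definition higher_energy :: "nat \<Rightarrow> (int ^ 'd) set \<Rightarrow> (int ^ 'd) set \<Rightarrow> nat" where
  "higher_energy k A B =
     card {(a, b). a \<in> {..<k} \<rightarrow>\<^sub>E A \<and> b \<in> {..<k} \<rightarrow>\<^sub>E B \<and>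
                   (\<forall>i<k. \<forall>j<k. a i - b i = a j - b j)}"

definition energy_exponent :: "nat \<Rightarrow> real" where
  "energy_exponent k = log 2 (2 + 2 ^ k)"

end

theory Submission
  imports Defs
begin

text \<open>
  Counting the \<open>k\<close>-tuples by their common difference \<open>x\<close> gives
  \<open>\<Sum>\<^sub>x r(x)\<^sup>k\<close> for the higher energy, where \<open>r(x)\<close> is the number of representations
  \<open>x = a - b\<close> (lemma \<open>higher_energy_eq_sum\<close>).

  The upper bound is proved by induction on the number of coordinates that are not constant on
  \<open>A\<close> or on \<open>B\<close> (lemma \<open>sum_diff_count_le\<close>). Splitting \<open>A\<close> and \<open>B\<close> according to one
  coordinate, into \<open>A\<^sub>0, B\<^sub>0\<close> (entry \<open>-1\<close>) and \<open>A\<^sub>1, B\<^sub>1\<close> (entry \<open>1\<close>),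
  splits the differences into three classes: those with entry \<open>0\<close> there come from the pairs \<open>A\<^sub>0, B\<^sub>0\<close> and \<open>A\<^sub>1, B\<^sub>1\<close> together, those with entry \<open>2\<close> from
  \<open>A\<^sub>1, B\<^sub>0\<close> only and those with entry \<open>-2\<close> from \<open>A\<^sub>0, B\<^sub>1\<close> only. Minkowski's inequality in
  \<open>\<ell>\<^sup>k\<close> for the first class and the induction hypothesis for all four pairs reduce the bound to an
  inequality for four nonnegative reals (lemma \<open>two_point_inequality\<close>): with
  \<open>q = log\<^sub>2 (2 + 2\<^sup>k)\<close> and \<open>t = q/k\<close>, it reads
  \<open>((a\<^sub>0 b\<^sub>0)\<^bsup>t/2\<^esup> + (a\<^sub>1 b\<^sub>1)\<^bsup>t/2\<^esup>)\<^sup>k + (a\<^sub>1 b\<^sub>0)\<^bsup>q/2\<^esup> + (a\<^sub>0 b\<^sub>1)\<^bsup>q/2\<^esup>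
     \<le> (a\<^sub>0 + a\<^sub>1)\<^bsup>q/2\<^esup> (b\<^sub>0 + b\<^sub>1)\<^bsup>q/2\<^esup>\<close>.

  The binomial expansion and the Cauchy--Schwarz inequality reduce this to the diagonal case
  \<open>(x\<^sup>t + y\<^sup>t)\<^sup>k + 2 (x y)\<^bsup>q/2\<^esup> \<le> (x + y)\<^sup>q\<close> (lemma \<open>two_point_diagonal\<close>). By homogeneity one may
  take \<open>x = e\<^sup>u\<close>, \<open>y = e\<^bsup>-u\<^esup>\<close> with \<open>u \<ge> 0\<close>. There is equality at \<open>u = 0\<close>, as \<open>2\<^sup>q = 2 + 2\<^sup>k\<close>, and
  the difference of the two sides is nondecreasing in \<open>u\<close>. The sign of its derivative is
  lemma \<open>power_powr_diff_le\<close>, which follows from the convexity of \<open>x \<mapsto> x\<^sup>p\<close> for \<open>p \<ge> 1\<close>.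

  The exponent is optimal because for the full cube \<open>A = B = {-1,1}\<^sup>d\<close> the energy factors over the
  coordinates and equals \<open>(2 + 2\<^sup>k)\<^sup>d\<close>, which is \<open>|A|\<^sup>q\<close>.
\<close>

section \<open>Inequalities for real powers\<close>

text \<open>
  After scaling to \<open>a + b = 1\<close> the claim reads \<open>b (1 - b\<^sup>p) \<le> a (1 - a\<^sup>p)\<close> with \<open>p = s - 1 \<ge> 1\<close>:
  the slope of the chord of \<open>x\<^sup>p\<close> from \<open>b\<close> to \<open>1\<close> is at most the slope of the
  chord from \<open>a\<close> to \<open>1\<close>, where \<open>1 - a = b\<close> and \<open>1 - b = a\<close>.
\<close>

lemma powr_diff_le:
  fixes a b s :: real
  assumes "0 < b" "b \<le> a" "2 \<le> s"
  shows "a powr s - b powr s \<le> (a + b) powr (s - 1) * (a - b)"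
proof -
  define c where "c = a + b"
  define p where "p = s - 1"
  have pos: "0 < a" "0 < c" using assms by (auto simp: c_def)
  \<comment> \<open>The point \<open>a\<close> lies between \<open>b\<close> and \<open>c = a + b\<close>; these are its barycentric weights.\<close>
  have "((1 - b / a) *\<^sub>R c + (b / a) *\<^sub>R b) powr p \<le> (1 - b / a) * c powr p + (b / a) * b powr p"
    by (rule convex_onD[OF powr_convex]) (use assms pos in \<open>auto simp: p_def\<close>)
  also have "(1 - b / a) *\<^sub>R c + (b / a) *\<^sub>R b = a"
    using pos by (simp add: c_def field_simps)
  finally have "a * a powr p \<le> a * ((1 - b / a) * c powr p + (b / a) * b powr p)"
    using pos by (intro mult_left_mono) auto
  also have "\<dots> = (a - b) * c powr p + b * b powr p"
    using pos by (simp add: field_simps)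
  finally show ?thesis
    using assms pos by (simp add: p_def c_def powr_mult_base mult.commute)
qed

lemma powr_power_real:
  fixes x s :: real
  assumes "0 < k"
  shows "(x powr s) ^ k = x powr (s * k)"
  using assms
  by (induction k rule: nat_induct_non_zero) (simp_all add: algebra_simps powr_add)

lemma powr_superadditive:
  fixes a b t :: real
  assumes "0 \<le> a" "0 \<le> b" "1 \<le> t"
  shows "a powr t + b powr t \<le> (a + b) powr t"
proof -
  have *: "x powr t \<le> x * (a + b) powr (t - 1)" if "0 \<le> x" "x \<le> a + b" for x
  proof -
    have "x powr t = x * x powr (t - 1)"
      using that by (simp add: powr_mult_base)
    also have "\<dots> \<le> x * (a + b) powr (t - 1)"
      using that assms by (intro mult_left_mono powr_mono2) auto
    finally show ?thesis .
  qed
  have "a powr t + b powr t \<le> (a + b) * (a + b) powr (t - 1)"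
    using *[of a] *[of b] assms by (simp add: algebra_simps)
  also have "\<dots> = (a + b) powr t"
    using assms by (simp add: powr_mult_base)
  finally show ?thesis .
qed

text \<open>
  Superadditivity disposes of the factor \<open>(a\<^sup>t + b\<^sup>t)\<^bsup>k-2\<^esup>\<close> and so reduces the claim to \<open>k = 2\<close>, where
  \<open>(a\<^sup>t + b\<^sup>t) (a\<^sup>t - b\<^sup>t) = a\<^bsup>2t\<^esup> - b\<^bsup>2t\<^esup>\<close>.
\<close>

lemma power_powr_diff_le:
  fixes a b t :: real
  assumes "0 < b" "b \<le> a" "1 \<le> t" "2 \<le> k"
  shows "(a powr t + b powr t) ^ (k - 1) * (a powr t - b powr t)
           \<le> (a + b) powr (t * k - 1) * (a - b)"
proof -
  obtain m where k: "k = m + 2" using assms by (metis add.commute le_Suc_ex)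
  have mono: "b powr t \<le> a powr t" using assms by (intro powr_mono2) auto
  have "(a powr t + b powr t) ^ (k - 1) * (a powr t - b powr t)
          = (a powr t + b powr t) ^ m * ((a powr t + b powr t) * (a powr t - b powr t))"
    by (simp add: k)
  also have "(a powr t + b powr t) * (a powr t - b powr t) = a powr (2 * t) - b powr (2 * t)"
    by (simp add: algebra_simps flip: powr_add)
  also have "(a powr t + b powr t) ^ m * \<dots>
               \<le> ((a + b) powr t) ^ m * ((a + b) powr (2 * t - 1) * (a - b))"
    using assms by (intro mult_mono power_mono powr_superadditive powr_diff_le)
      (auto intro!: powr_mono2)
  also have "\<dots> = ((a + b) powr (t * m) * (a + b) powr (2 * t - 1)) * (a - b)"
    using assms by (simp add: powr_power mult.commute)
  also have "(a + b) powr (t * m) * (a + b) powr (2 * t - 1) = (a + b) powr (t * k - 1)"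
    by (simp add: k algebra_simps flip: powr_add)
  finally show ?thesis .
qed

section \<open>The two-point inequality\<close>

text \<open>
  The inequality compares the values at \<open>0\<close> and at \<open>u\<close> of a function whose derivative is
  nonnegative by lemma \<open>power_powr_diff_le\<close>, applied to \<open>a = e\<^sup>u\<close> and \<open>b = e\<^bsup>-u\<^esup>\<close>.
\<close>

lemma cosh_inequality:
  fixes t u :: real
  assumes "1 \<le> t" "2 \<le> k" "0 \<le> u"
  shows "2 powr (t * k) - 2 ^ k
           \<le> (exp u + exp (- u)) powr (t * k) - (exp (t * u) + exp (- (t * u))) ^ k"
proof -
  define F where "F u = (exp u + exp (- u)) powr (t * k) - (exp (t * u) + exp (- (t * u))) ^ k"
    for u :: real
  define D where "D u = t * k * ((exp u + exp (- u)) powr (t * k - 1) * (exp u - exp (- u))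
      - (exp (t * u) + exp (- (t * u))) ^ (k - 1) * (exp (t * u) - exp (- (t * u))))" for u :: real
  have deriv: "(F has_real_derivative D x) (at x)" for x
  proof -
    have "0 < exp x + exp (- x)" by (simp add: add_pos_pos)
    then show ?thesis
      unfolding F_def D_def
      by (auto intro!: derivative_eq_intros simp: powr_diff field_simps)
  qed
  have "0 \<le> D x" if "0 \<le> x" for x
    unfolding D_def
    using power_powr_diff_le[of "exp (- x)" "exp x" t k] assms that
    by (intro mult_nonneg_nonneg) (auto simp: powr_def)
  then have "F 0 \<le> F u"
    by (intro DERIV_nonneg_imp_nondecreasing[OF assms(3)]) (use deriv in blast)
  then show ?thesis by (simp add: F_def)
qed

lemma two_point_diagonal:
  fixes x y t :: real
  assumes "0 \<le> x" "0 \<le> y" "1 \<le> t" "2 \<le> k" "2 powr (t * k) = 2 + 2 ^ k"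
  shows "(x powr t + y powr t) ^ k + 2 * (x * y) powr (t * k / 2) \<le> (x + y) powr (t * k)"
proof (cases "x = 0 \<or> y = 0")
  case True
  then show ?thesis using assms by (auto simp: powr_power_real)
next
  case False
  have main: "(x powr t + y powr t) ^ k + 2 * (x * y) powr (t * k / 2) \<le> (x + y) powr (t * k)"
    if "0 < y" "y \<le> x" for x y :: real
  proof -
    \<comment> \<open>Homogeneity: write \<open>x = c e\<^sup>u\<close> and \<open>y = c e\<^bsup>-u\<^esup>\<close>.\<close>
    define c u where "c = sqrt (x * y)" and "u = ln (x / y) / 2"
    have c: "0 < c" and u: "0 \<le> u" using that by (auto simp: c_def u_def)
    have "exp u = sqrt (x / y)"
      using that by (intro real_sqrt_unique[symmetric]) (auto simp: u_def simp flip: exp_of_nat_mult)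
    then have e: "exp u = sqrt x / sqrt y" by (simp add: real_sqrt_divide)
    have x: "x = c * exp u" and y: "y = c * exp (- u)"
      using that by (auto simp: c_def exp_minus e real_sqrt_mult)
    have "(x powr t + y powr t) ^ k + 2 * (x * y) powr (t * k / 2)
           = c powr (t * k) * ((exp (t * u) + exp (- (t * u))) ^ k + 2)"
    proof -
      have "x powr t + y powr t = c powr t * (exp (t * u) + exp (- (t * u)))"
        using c by (simp add: x y powr_mult exp_powr_real algebra_simps)
      then have "(x powr t + y powr t) ^ k = c powr (t * k) * (exp (t * u) + exp (- (t * u))) ^ k"
        using assms(4) by (simp add: power_mult_distrib powr_power_real)
      moreover have "x * y = c powr 2"
        using that by (simp add: c_def)
      then have "(x * y) powr (t * k / 2) = c powr (t * k)"
        by (simp only: powr_powr) simp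
      ultimately show ?thesis
        by (simp add: distrib_left)
    qed
    also have "\<dots> \<le> c powr (t * k) * (exp u + exp (- u)) powr (t * k)"
      using cosh_inequality[OF assms(3,4) u] assms(5) by (intro mult_left_mono) auto
    also have "\<dots> = (x + y) powr (t * k)"
      using c by (simp add: x y add_pos_pos flip: powr_mult distrib_left)
    finally show ?thesis .
  qed
  from False show ?thesis
    using main[of y x] main[of x y] assms by (cases "y \<le> x") (auto simp: add.commute mult.commute)
qed

text \<open>
  The left-hand base is the inner product of two vectors indexed by \<open>{1..k}\<close>. The entries with
  \<open>0 < j < k\<close> come from the middle terms of the binomial expansion. The two end terms
  \<open>a\<^sub>0\<^sup>k b\<^sub>0\<^sup>k\<close> and \<open>a\<^sub>1\<^sup>k b\<^sub>1\<^sup>k\<close> combine with the two cross terms into the single product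
  \<open>(a\<^sub>0\<^sup>k + a\<^sub>1\<^sup>k) (b\<^sub>0\<^sup>k + b\<^sub>1\<^sup>k)\<close>, which is the entry with \<open>j = k\<close>.
\<close>

lemma power_sum_Cauchy_Schwarz:
  fixes a0 a1 b0 b1 :: real
  assumes "0 < k"
  shows "((a0 * b0 + a1 * b1) ^ k + (a1 * b0) ^ k + (a0 * b1) ^ k)\<^sup>2
          \<le> ((a0\<^sup>2 + a1\<^sup>2) ^ k + 2 * (a0 * a1) ^ k) * ((b0\<^sup>2 + b1\<^sup>2) ^ k + 2 * (b0 * b1) ^ k)"
proof -
  define u where "u x y j = (if j = k then x ^ k + y ^ k
      else sqrt (real (k choose j)) * x ^ j * y ^ (k - j))" for x y :: real and j
  have expand: "(\<Sum>j\<in>{1..k}. u x y j * u z w j) = (x * z + y * w) ^ k + (y * z) ^ k + (x * w) ^ k"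
    for x y z w
  proof -
    have split: "{..k} = insert 0 (insert k {1..<k})" "{1..k} = insert k {1..<k}"
      using assms by auto
    have "(\<Sum>j\<in>{1..<k}. u x y j * u z w j)
        = (\<Sum>j\<in>{1..<k}. real (k choose j) * (x * z) ^ j * (y * w) ^ (k - j))"
      by (intro sum.cong) (auto simp: u_def power_mult_distrib)
    then show ?thesis
      using assms unfolding binomial_ring split
      by (simp add: u_def power_mult_distrib algebra_simps)
  qed
  have "(\<Sum>j\<in>{1..k}. u a0 a1 j * u b0 b1 j)\<^sup>2
          \<le> (\<Sum>j\<in>{1..k}. (u a0 a1 j)\<^sup>2) * (\<Sum>j\<in>{1..k}. (u b0 b1 j)\<^sup>2)"
    by (rule Cauchy_Schwarz_ineq_sum)
  moreover have "(\<Sum>j\<in>{1..k}. (u x y j)\<^sup>2) = (x\<^sup>2 + y\<^sup>2) ^ k + 2 * (x * y) ^ k" for x y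
    using expand[of x y x y] by (simp add: power2_eq_square mult.commute)
  ultimately show ?thesis
    by (simp only: expand)
qed

lemma two_point_inequality:
  fixes a0 a1 b0 b1 t :: real
  assumes "0 \<le> a0" "0 \<le> a1" "0 \<le> b0" "0 \<le> b1"
    and t: "1 \<le> t" "2 \<le> k" "2 powr (t * k) = 2 + 2 ^ k"
  shows "((a0 * b0) powr (t / 2) + (a1 * b1) powr (t / 2)) ^ k
           + (a1 * b0) powr (t * k / 2) + (a0 * b1) powr (t * k / 2)
         \<le> (a0 + a1) powr (t * k / 2) * (b0 + b1) powr (t * k / 2)"
    (is "?L \<le> ?R")
proof (rule power2_le_imp_le)
  have pw: "(x * y) powr (t * k / 2) = (x powr (t / 2) * y powr (t / 2)) ^ k"
    if "0 \<le> x" "0 \<le> y" for x y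
    using that t(2) powr_power_real[of k "x * y" "t / 2"] by (simp add: powr_mult)
  have pt: "(x * y) powr (t / 2) = x powr (t / 2) * y powr (t / 2)" if "0 \<le> x" "0 \<le> y" for x y
    using that by (simp add: powr_mult)
  have sq: "(x powr (r / 2))\<^sup>2 = x powr r" for x r :: real
    using powr_power_real[of 2 x "r / 2"] by simp
  have "?L\<^sup>2 \<le> (((a0 powr (t/2))\<^sup>2 + (a1 powr (t/2))\<^sup>2) ^ k + 2 * (a0 powr (t/2) * a1 powr (t/2)) ^ k)
           * (((b0 powr (t/2))\<^sup>2 + (b1 powr (t/2))\<^sup>2) ^ k + 2 * (b0 powr (t/2) * b1 powr (t/2)) ^ k)"
    using power_sum_Cauchy_Schwarz[of k "a0 powr (t/2)" "b0 powr (t/2)" "a1 powr (t/2)" "b1 powr (t/2)"]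
      assms by (simp add: pw pt)
  also have "\<dots> \<le> (a0 + a1) powr (t * k) * (b0 + b1) powr (t * k)"
    using two_point_diagonal[of a0 a1 t k] two_point_diagonal[of b0 b1 t k] assms
    by (intro mult_mono) (auto simp: sq pw)
  also have "\<dots> = ?R\<^sup>2"
    by (simp add: power_mult_distrib sq)
  finally show "?L\<^sup>2 \<le> ?R\<^sup>2" .
qed (use assms in auto)

section \<open>Minkowski's inequality for sums of powers\<close>

lemma power_weighted_convex:
  fixes x y :: real
  assumes "0 \<le> x" "0 \<le> y" "0 < \<alpha>" "0 < \<beta>" "0 < k"
  shows "(x + y) ^ k \<le> (\<alpha> + \<beta>) ^ (k - 1) * (\<alpha> * (x / \<alpha>) ^ k + \<beta> * (y / \<beta>) ^ k)"
proof -
  define s where "s = \<alpha> + \<beta>"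
  have s: "0 < s" using assms by (simp add: s_def)
  have cvx: "convex_on {0::real..} (\<lambda>x. x ^ k)"
    by (cases "even k")
      (auto intro: convex_power_odd convex_on_subset[OF convex_power_even])
  have "((1 - \<beta> / s) *\<^sub>R (x / \<alpha>) + (\<beta> / s) *\<^sub>R (y / \<beta>)) ^ k
          \<le> (1 - \<beta> / s) * (x / \<alpha>) ^ k + (\<beta> / s) * (y / \<beta>) ^ k"
    by (rule convex_onD[OF cvx]) (use assms in \<open>auto simp: s_def\<close>)
  moreover have "1 - \<beta> / s = \<alpha> / s" using s by (simp add: s_def field_simps)
  ultimately have "((x + y) / s) ^ k \<le> (\<alpha> * (x / \<alpha>) ^ k + \<beta> * (y / \<beta>) ^ k) / s"
    using assms by (simp add: add_divide_distrib)
  then have "s ^ k * ((x + y) / s) ^ k \<le> s ^ k * ((\<alpha> * (x / \<alpha>) ^ k + \<beta> * (y / \<beta>) ^ k) / s)"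
    using s by (intro mult_left_mono) auto
  moreover have "s ^ k = s ^ (k - 1) * s"
    using assms by (metis Suc_diff_1 power_Suc2)
  ultimately show ?thesis
    using s by (simp add: power_divide flip: s_def)
qed

text \<open>
  Minkowski's inequality in \<open>\<ell>\<^sup>k\<close>, stated for upper bounds \<open>\<alpha>\<close> and \<open>\<beta>\<close> of the norms so that no
  roots are needed.
\<close>

lemma Minkowski_power_sum:
  fixes f g :: "'a \<Rightarrow> real"
  assumes "finite D" "\<And>x. x \<in> D \<Longrightarrow> 0 \<le> f x" "\<And>x. x \<in> D \<Longrightarrow> 0 \<le> g x"
    and \<alpha>: "0 \<le> \<alpha>" "(\<Sum>x\<in>D. f x ^ k) \<le> \<alpha> ^ k" and \<beta>: "0 \<le> \<beta>" "(\<Sum>x\<in>D. g x ^ k) \<le> \<beta> ^ k"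
    and k: "0 < k"
  shows "(\<Sum>x\<in>D. (f x + g x) ^ k) \<le> (\<alpha> + \<beta>) ^ k"
proof -
  have vanish: "h x = 0" if "\<And>x. x \<in> D \<Longrightarrow> 0 \<le> h x" "(\<Sum>x\<in>D. h x ^ k) \<le> 0 ^ k" "x \<in> D"
    for h :: "'a \<Rightarrow> real" and x
  proof -
    have "h x ^ k \<le> (\<Sum>x\<in>D. h x ^ k)"
      using that assms(1) by (intro member_le_sum) auto
    with that k have "h x ^ k \<le> 0" by (simp add: zero_power)
    with that(1)[OF that(3)] show ?thesis
      by (metis linorder_not_less order_le_less zero_less_power)
  qed
  consider "\<alpha> = 0" | "\<beta> = 0" | "0 < \<alpha>" "0 < \<beta>" using \<alpha> \<beta> by linarith
  then show ?thesis
  proof cases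
    case 1
    have "f x = 0" if "x \<in> D" for x
      by (rule vanish[OF assms(2) _ that]) (use 1 \<alpha> in auto)
    then have "(\<Sum>x\<in>D. (f x + g x) ^ k) = (\<Sum>x\<in>D. g x ^ k)"
      by simp
    with 1 \<beta> show ?thesis by simp
  next
    case 2
    have "g x = 0" if "x \<in> D" for x
      by (rule vanish[OF assms(3) _ that]) (use 2 \<beta> in auto)
    then have "(\<Sum>x\<in>D. (f x + g x) ^ k) = (\<Sum>x\<in>D. f x ^ k)"
      by simp
    with 2 \<alpha> show ?thesis by simp
  next
    case 3
    have "(\<Sum>x\<in>D. (f x + g x) ^ k)
        \<le> (\<Sum>x\<in>D. (\<alpha> + \<beta>) ^ (k - 1) * (\<alpha> * (f x / \<alpha>) ^ k + \<beta> * (g x / \<beta>) ^ k))"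
      using assms 3 by (intro sum_mono power_weighted_convex) auto
    also have "\<dots> = (\<alpha> + \<beta>) ^ (k - 1) * (\<alpha> * ((\<Sum>x\<in>D. f x ^ k) / \<alpha> ^ k) + \<beta> * ((\<Sum>x\<in>D. g x ^ k) / \<beta> ^ k))"
      by (simp add: power_divide sum.distrib flip: sum_divide_distrib sum_distrib_left)
    also have "\<dots> \<le> (\<alpha> + \<beta>) ^ (k - 1) * (\<alpha> * 1 + \<beta> * 1)"
      using \<alpha> \<beta> 3 by (intro mult_left_mono add_mono) auto
    also have "\<dots> = (\<alpha> + \<beta>) ^ k"
      using k by (metis Suc_diff_1 mult.right_neutral power_Suc2)
    finally show ?thesis .
  qed
qed
section \<open>Product sets of vectors\<close>

lemma bij_betw_vec_nth_PiE:
  "bij_betw vec_nth {v :: 'a ^ 'n. \<forall>i. v $ i \<in> S i} (Pi\<^sub>E UNIV S)"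
  by (rule bij_betw_byWitness[where f' = vec_lambda]) auto

lemma finite_vec_Collect:
  assumes "\<And>i. finite (S i)"
  shows "finite {v :: 'a ^ 'n. \<forall>i. v $ i \<in> S i}"
  using bij_betw_finite[OF bij_betw_vec_nth_PiE[of S]] assms by (simp add: finite_PiE)

lemma card_vec_Collect:
  "card {v :: 'a ^ 'n. \<forall>i. v $ i \<in> S i} = (\<Prod>i\<in>UNIV. card (S i))"
  using bij_betw_same_card[OF bij_betw_vec_nth_PiE[of S]] by (simp add: card_PiE)

lemma sum_prod_vec:
  fixes w :: "'a \<Rightarrow> 'b :: comm_semiring_1"
  assumes "finite T"
  shows "(\<Sum>v \<in> {v :: 'a ^ 'n. \<forall>i. v $ i \<in> T}. \<Prod>i\<in>UNIV. w (v $ i)) = (\<Sum>y\<in>T. w y) ^ CARD('n)"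
proof -
  have "(\<Sum>v \<in> {v :: 'a ^ 'n. \<forall>i. v $ i \<in> T}. \<Prod>i\<in>UNIV. w (v $ i))
          = (\<Sum>g \<in> Pi\<^sub>E UNIV (\<lambda>_ :: 'n. T). \<Prod>i\<in>UNIV. w (g i))"
    by (rule sum.reindex_bij_betw[OF bij_betw_vec_nth_PiE[of "\<lambda>_. T"]])
  also have "\<dots> = (\<Prod>i\<in>(UNIV :: 'n set). \<Sum>y\<in>T. w y)"
    using assms by (intro prod_sum_PiE[symmetric]) auto
  finally show ?thesis by simp
qed

section \<open>Energy as a sum over differences\<close>

text \<open>
  The number of pairs \<open>(a, b) \<in> A \<times> B\<close> with \<open>a - b = x\<close>, counted by the first component, which
  determines the second.
\<close>

definition diff_count :: "(int ^ 'd) set \<Rightarrow> (int ^ 'd) set \<Rightarrow> int ^ 'd \<Rightarrow> nat" where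
  "diff_count A B x = card {a \<in> A. a - x \<in> B}"

text \<open>The set \<open>{-2,0,2}\<^sup>d\<close> of all differences of two points of the cube.\<close>

definition diff_cube :: "(int ^ 'd) set" where
  "diff_cube = {x. \<forall>i. x $ i \<in> {-2, 0, 2}}"

lemma finite_sign_cube: "finite (sign_cube :: (int ^ 'd) set)"
  unfolding sign_cube_def by (rule finite_vec_Collect) simp

lemma finite_diff_cube: "finite (diff_cube :: (int ^ 'd) set)"
  unfolding diff_cube_def by (rule finite_vec_Collect) simp

lemma diff_in_diff_cube:
  assumes "a \<in> sign_cube" "b \<in> sign_cube"
  shows "a - b \<in> diff_cube"
proof -
  have "(a - b) $ i \<in> {-2, 0, 2}" for i
  proof -
    have "a $ i \<in> {-1, 1}" "b $ i \<in> {-1, 1}"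
      using assms unfolding sign_cube_def by blast+
    then show ?thesis by auto
  qed
  then show ?thesis unfolding diff_cube_def by blast
qed

text \<open>
  A tuple with common difference \<open>x\<close> is determined by its \<open>A\<close>-half, which is an arbitrary \<open>k\<close>-tuple
  over \<open>{a \<in> A. a - x \<in> B}\<close>.
\<close>

lemma higher_energy_eq_sum:
  fixes A B :: "(int ^ 'd) set"
  assumes "0 < k" and A: "A \<subseteq> sign_cube" and B: "B \<subseteq> sign_cube"
  shows "higher_energy k A B = (\<Sum>x\<in>diff_cube. diff_count A B x ^ k)"
proof -
  define F where "F x = (\<lambda>a. (a, \<lambda>i\<in>{..<k}. a i - x)) ` ({..<k} \<rightarrow>\<^sub>E {a \<in> A. a - x \<in> B})"
    for x :: "int ^ 'd"
  have fin: "finite {a \<in> A. P a}" for P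
    using finite_subset[OF A finite_sign_cube] by simp
  have F_iff: "(a, b) \<in> F x \<longleftrightarrow> a \<in> {..<k} \<rightarrow>\<^sub>E A \<and> b \<in> {..<k} \<rightarrow>\<^sub>E B \<and> (\<forall>i<k. a i - b i = x)" for a b x
  proof
    assume "(a, b) \<in> F x"
    then show "a \<in> {..<k} \<rightarrow>\<^sub>E A \<and> b \<in> {..<k} \<rightarrow>\<^sub>E B \<and> (\<forall>i<k. a i - b i = x)"
      unfolding F_def by (elim imageE) (simp add: PiE_iff)
  next
    assume *: "a \<in> {..<k} \<rightarrow>\<^sub>E A \<and> b \<in> {..<k} \<rightarrow>\<^sub>E B \<and> (\<forall>i<k. a i - b i = x)"
    then have eq: "b i = a i - x" if "i < k" for i using that by (auto simp: algebra_simps)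
    have "b = (\<lambda>i\<in>{..<k}. a i - x)"
    proof
      fix i show "b i = (\<lambda>i\<in>{..<k}. a i - x) i"
        using * eq[of i] by (cases "i < k") (auto simp: PiE_iff extensional_def)
    qed
    moreover have "a \<in> {..<k} \<rightarrow>\<^sub>E {a \<in> A. a - x \<in> B}"
      using * by (auto simp: PiE_iff simp flip: eq)
    ultimately show "(a, b) \<in> F x" unfolding F_def by blast
  qed
  have "{(a, b). a \<in> {..<k} \<rightarrow>\<^sub>E A \<and> b \<in> {..<k} \<rightarrow>\<^sub>E B \<and> (\<forall>i<k. \<forall>j<k. a i - b i = a j - b j)}
          = (\<Union>x\<in>diff_cube. F x)" (is "?S = _")
  proof (intro set_eqI iffI)
    fix p assume p: "p \<in> ?S"
    obtain a b where ab: "p = (a, b)" by (cases p)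
    from p ab have "a 0 \<in> A" "b 0 \<in> B" using assms(1) by (auto simp: PiE_iff)
    then have "a 0 \<in> sign_cube" "b 0 \<in> sign_cube" using A B by blast+
    then have "a 0 - b 0 \<in> diff_cube" by (rule diff_in_diff_cube)
    moreover have "(a, b) \<in> F (a 0 - b 0)" using p assms(1) unfolding F_iff ab by blast
    ultimately show "p \<in> (\<Union>x\<in>diff_cube. F x)" unfolding ab by blast
  next
    fix p assume "p \<in> (\<Union>x\<in>diff_cube. F x)"
    then obtain x where x: "p \<in> F x" by blast
    obtain a b where ab: "p = (a, b)" by (cases p)
    from x show "p \<in> ?S" unfolding ab F_iff by simp
  qed
  moreover have "card (\<Union>x\<in>diff_cube. F x) = (\<Sum>x\<in>diff_cube. card (F x))"
  proof (rule card_UN_disjoint[OF finite_diff_cube])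
    show "\<forall>x\<in>diff_cube. finite (F x)"
      unfolding F_def using fin by (auto intro!: finite_PiE)
    show "\<forall>x\<in>diff_cube. \<forall>y\<in>diff_cube. x \<noteq> y \<longrightarrow> F x \<inter> F y = {}"
    proof (intro ballI impI equals0I)
      fix x y p assume "x \<noteq> y" and p: "p \<in> F x \<inter> F y"
      obtain a b where ab: "p = (a, b)" by (cases p)
      from p have "a 0 - b 0 = x" "a 0 - b 0 = y"
        using assms(1) unfolding ab Int_iff F_iff by blast+
      with \<open>x \<noteq> y\<close> show False by simp
    qed
  qed
  moreover have "card (F x) = diff_count A B x ^ k" for x
    unfolding F_def diff_count_def
    by (subst card_image) (auto simp: inj_on_def card_funcsetE)
  ultimately show ?thesis unfolding higher_energy_def by simp
qed

section \<open>Upper bound by induction on the coordinates\<close>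

text \<open>
  At each \<open>x\<close> only one of the three terms on the right can be nonzero; the entry of \<open>x\<close> at the
  splitting coordinate selects it.
\<close>

lemma diff_count_split:
  fixes A B :: "(int ^ 'd) set" and i :: 'd
  assumes "A \<subseteq> sign_cube" "B \<subseteq> sign_cube" "x \<in> diff_cube" "0 < k"
  defines "A1 \<equiv> {a \<in> A. a $ i = 1}" and "A0 \<equiv> {a \<in> A. a $ i = -1}"
    and "B1 \<equiv> {b \<in> B. b $ i = 1}" and "B0 \<equiv> {b \<in> B. b $ i = -1}"
  shows "diff_count A B x ^ k \<le> (diff_count A0 B0 x + diff_count A1 B1 x) ^ k
           + diff_count A1 B0 x ^ k + diff_count A0 B1 x ^ k"
proof -
  have sgn: "a $ i = -1 \<or> a $ i = 1" if "a \<in> A \<or> a \<in> B" for a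
    using that assms(1,2) unfolding sign_cube_def by blast
  have "x $ i \<in> {-2, 0, 2}" using assms(3) unfolding diff_cube_def by blast
  then consider "x $ i = 0" | "x $ i = 2" | "x $ i = -2" by blast
  then show ?thesis
  proof cases
    case 1
    have "a \<in> {a \<in> A0. a - x \<in> B0} \<union> {a \<in> A1. a - x \<in> B1}" if "a \<in> A" "a - x \<in> B" for a
      using sgn[of a] that 1 by (simp add: A0_def A1_def B0_def B1_def)
    moreover have "A0 \<subseteq> A" "A1 \<subseteq> A" "B0 \<subseteq> B" "B1 \<subseteq> B"
      unfolding A0_def A1_def B0_def B1_def by blast+
    ultimately have "{a \<in> A. a - x \<in> B} = {a \<in> A0. a - x \<in> B0} \<union> {a \<in> A1. a - x \<in> B1}"
      by blast
    then have "diff_count A B x \<le> diff_count A0 B0 x + diff_count A1 B1 x"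
      unfolding diff_count_def by (simp only: card_Un_le)
    then have "diff_count A B x ^ k \<le> (diff_count A0 B0 x + diff_count A1 B1 x) ^ k"
      by (rule power_mono) simp
    then show ?thesis by linarith
  next
    case 2
    have "a \<in> A \<and> a - x \<in> B \<longleftrightarrow> a \<in> A1 \<and> a - x \<in> B0" for a
      using sgn[of a] sgn[of "a - x"] 2 unfolding A1_def B0_def mem_Collect_eq by fastforce
    then show ?thesis unfolding diff_count_def by simp
  next
    case 3
    have "a \<in> A \<and> a - x \<in> B \<longleftrightarrow> a \<in> A0 \<and> a - x \<in> B1" for a
      using sgn[of a] sgn[of "a - x"] 3 unfolding A0_def B1_def mem_Collect_eq by fastforce
    then show ?thesis unfolding diff_count_def by simp
  qed
qed

text \<open>
  The finite set \<open>I\<close> contains every coordinate that varies within \<open>A\<close> or within \<open>B\<close>. This keeps the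
  ambient space, whose dimension is a type, fixed during the induction. Off \<open>I\<close> the constant entries
  of \<open>A\<close> and of \<open>B\<close> may differ. When \<open>I\<close> is empty, both sets have at most one element.
\<close>

lemma sum_diff_count_le:
  fixes A B :: "(int ^ 'd) set" and t :: real
  assumes t: "1 \<le> t" "2 \<le> k" "2 powr (t * k) = 2 + 2 ^ k"
  assumes "finite I" "A \<subseteq> sign_cube" "B \<subseteq> sign_cube"
    and "\<And>x y j. x \<in> A \<Longrightarrow> y \<in> A \<Longrightarrow> j \<notin> I \<Longrightarrow> x $ j = y $ j"
    and "\<And>x y j. x \<in> B \<Longrightarrow> y \<in> B \<Longrightarrow> j \<notin> I \<Longrightarrow> x $ j = y $ j"
  shows "(\<Sum>x\<in>diff_cube. real (diff_count A B x) ^ k)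
           \<le> real (card A) powr (t * k / 2) * real (card B) powr (t * k / 2)"
  using assms(4-)
proof (induction I arbitrary: A B rule: finite_induct)
  case empty
  show ?case
  proof (cases "A = {} \<or> B = {}")
    case True
    then show ?thesis using t(2) by (auto simp: diff_count_def zero_power)
  next
    case False
    then obtain a b where ab: "a \<in> A" "b \<in> B" by blast
    have "x = a" if "x \<in> A" for x
      using empty.prems(3)[OF that ab(1)] by (simp add: vec_eq_iff)
    with ab(1) have A: "A = {a}" by blast
    have "x = b" if "x \<in> B" for x
      using empty.prems(4)[OF that ab(2)] by (simp add: vec_eq_iff)
    with ab(2) have B: "B = {b}" by blast
    have "{a' \<in> {a}. a' - x \<in> {b}} = (if x = a - b then {a} else {})" for x
      by auto
    then have "real (diff_count A B x) ^ k = (if x = a - b then 1 else 0)" for x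
      using t(2) unfolding diff_count_def A B by simp
    then show ?thesis
      by (simp add: A B finite_diff_cube)
  qed
next
  case (insert i I)
  define A1 A0 where "A1 = {a \<in> A. a $ i = 1}" and "A0 = {a \<in> A. a $ i = -1}"
  define B1 B0 where "B1 = {b \<in> B. b $ i = 1}" and "B0 = {b \<in> B. b $ i = -1}"
  note defs = A1_def A0_def B1_def B0_def
  let ?S = "\<lambda>A B. \<Sum>x\<in>diff_cube. real (diff_count A B x) ^ k"
  let ?n = "\<lambda>A. real (card A)"
  have IH: "?S A' B' \<le> (?n A' * ?n B') powr (t * k / 2)"
    if "A' \<in> {A0, A1}" "B' \<in> {B0, B1}" for A' B'
  proof -
    have "?S A' B' \<le> ?n A' powr (t * k / 2) * ?n B' powr (t * k / 2)"
    proof (rule insert.IH)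
      show "A' \<subseteq> sign_cube" "B' \<subseteq> sign_cube"
        using that insert.prems(1,2) unfolding defs by blast+
      show "x $ j = y $ j" if "x \<in> A'" "y \<in> A'" "j \<notin> I" for x y j
      proof (cases "j = i")
        case True
        with that \<open>A' \<in> _\<close> show ?thesis by (auto simp: defs)
      next
        case False
        from that(1,2) \<open>A' \<in> _\<close> have "x \<in> A" "y \<in> A" by (auto simp: defs)
        with False that(3) insert.prems(3)[of x y j] show ?thesis by blast
      qed
      show "x $ j = y $ j" if "x \<in> B'" "y \<in> B'" "j \<notin> I" for x y j
      proof (cases "j = i")
        case True
        with that \<open>B' \<in> _\<close> show ?thesis by (auto simp: defs)
      next
        case False
        from that(1,2) \<open>B' \<in> _\<close> have "x \<in> B" "y \<in> B" by (auto simp: defs)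
        with False that(3) insert.prems(4)[of x y j] show ?thesis by blast
      qed
    qed
    then show ?thesis by (simp add: powr_mult)
  qed
  have split_card: "?n A = ?n A0 + ?n A1" "?n B = ?n B0 + ?n B1"
  proof -
    have fin: "finite A" "finite B"
      using insert.prems(1,2) finite_sign_cube finite_subset by blast+
    have "a $ i = -1 \<or> a $ i = 1" if "a \<in> A \<or> a \<in> B" for a
      using that insert.prems(1,2) unfolding sign_cube_def by blast
    then have "A = A0 \<union> A1" "B = B0 \<union> B1" by (auto simp: defs)
    moreover have "A0 \<inter> A1 = {}" "B0 \<inter> B1 = {}" by (auto simp: defs)
    ultimately show "?n A = ?n A0 + ?n A1" "?n B = ?n B0 + ?n B1"
      using fin by (metis card_Un_disjoint finite_Un of_nat_add)+
  qed
  have "?S A B \<le> (\<Sum>x\<in>diff_cube. (real (diff_count A0 B0 x) + real (diff_count A1 B1 x)) ^ k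
           + real (diff_count A1 B0 x) ^ k + real (diff_count A0 B1 x) ^ k)"
  proof (rule sum_mono)
    fix x :: "int ^ 'd" assume "x \<in> diff_cube"
    then have "diff_count A B x ^ k \<le> (diff_count A0 B0 x + diff_count A1 B1 x) ^ k
           + diff_count A1 B0 x ^ k + diff_count A0 B1 x ^ k"
      unfolding defs using insert.prems(1,2) t(2) by (intro diff_count_split) auto
    then show "real (diff_count A B x) ^ k \<le> (real (diff_count A0 B0 x) + real (diff_count A1 B1 x)) ^ k
           + real (diff_count A1 B0 x) ^ k + real (diff_count A0 B1 x) ^ k"
      by (metis (mono_tags, lifting) of_nat_add of_nat_le_iff of_nat_power)
  qed
  also have "\<dots> = (\<Sum>x\<in>diff_cube. (real (diff_count A0 B0 x) + real (diff_count A1 B1 x)) ^ k)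
           + ?S A1 B0 + ?S A0 B1"
    by (simp add: sum.distrib)
  also have "\<dots> \<le> ((?n A0 * ?n B0) powr (t / 2) + (?n A1 * ?n B1) powr (t / 2)) ^ k
           + (?n A1 * ?n B0) powr (t * k / 2) + (?n A0 * ?n B1) powr (t * k / 2)"
  proof -
    have pw: "(x powr (t / 2)) ^ k = x powr (t * k / 2)" for x :: real
      using t(2) powr_power_real[of k x "t / 2"] by simp
    have S00: "?S A0 B0 \<le> ((?n A0 * ?n B0) powr (t / 2)) ^ k"
      unfolding pw by (rule IH) simp_all
    have S11: "?S A1 B1 \<le> ((?n A1 * ?n B1) powr (t / 2)) ^ k"
      unfolding pw by (rule IH) simp_all
    have S10: "?S A1 B0 \<le> (?n A1 * ?n B0) powr (t * k / 2)"
      by (rule IH) simp_all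
    have S01: "?S A0 B1 \<le> (?n A0 * ?n B1) powr (t * k / 2)"
      by (rule IH) simp_all
    have "(\<Sum>x\<in>diff_cube. (real (diff_count A0 B0 x) + real (diff_count A1 B1 x)) ^ k)
        \<le> ((?n A0 * ?n B0) powr (t / 2) + (?n A1 * ?n B1) powr (t / 2)) ^ k"
      by (rule Minkowski_power_sum[OF finite_diff_cube _ _ _ S00 _ S11]) (use t(2) in simp_all)
    with S10 S01 show ?thesis by linarith
  qed
  also have "\<dots> \<le> ?n A powr (t * k / 2) * ?n B powr (t * k / 2)"
    unfolding split_card using t by (intro two_point_inequality) auto
  finally show ?case .
qed

section \<open>Energy of the full cube\<close>

lemma card_sign_cube: "card (sign_cube :: (int ^ 'd) set) = 2 ^ CARD('d)"
  unfolding sign_cube_def card_vec_Collect by (simp add: numeral_2_eq_2)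

lemma higher_energy_sign_cube:
  assumes "0 < k"
  shows "higher_energy k (sign_cube :: (int ^ 'd) set) sign_cube = (2 + 2 ^ k) ^ CARD('d)"
proof -
  \<comment> \<open>The contribution of a single coordinate with difference \<open>y\<close>.\<close>
  define w where "w y = card {s \<in> {-1, 1}. s - y \<in> {-1, 1 :: int}} ^ k" for y
  have w: "w (-2) = 1" "w 0 = 2 ^ k" "w 2 = 1"
  proof -
    have "{s \<in> {-1, 1}. s - (-2) \<in> {-1, 1 :: int}} = {-1}"
      "{s \<in> {-1, 1}. s - 0 \<in> {-1, 1 :: int}} = {-1, 1}"
      "{s \<in> {-1, 1}. s - 2 \<in> {-1, 1 :: int}} = {1}" by auto
    then show "w (-2) = 1" "w 0 = 2 ^ k" "w 2 = 1" unfolding w_def by (simp_all add: numeral_2_eq_2)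
  qed
  have "diff_count sign_cube sign_cube x ^ k = (\<Prod>i\<in>UNIV. w (x $ i))" for x :: "int ^ 'd"
  proof -
    have "{a \<in> sign_cube. a - x \<in> sign_cube} = {a. \<forall>i. a $ i \<in> {s \<in> {-1, 1}. s - x $ i \<in> {-1, 1}}}"
      unfolding sign_cube_def by auto
    then show ?thesis
      unfolding diff_count_def w_def card_vec_Collect by (simp only: prod_power_distrib card_vec_Collect)
  qed
  then have "higher_energy k (sign_cube :: (int ^ 'd) set) sign_cube
      = (\<Sum>x\<in>(diff_cube :: (int ^ 'd) set). \<Prod>i\<in>UNIV. w (x $ i))"
    by (simp add: higher_energy_eq_sum[OF assms])
  also have "\<dots> = (\<Sum>y\<in>{-2, 0, 2}. w y) ^ CARD('d)"
    unfolding diff_cube_def by (rule sum_prod_vec) simp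
  also have "(\<Sum>y\<in>{-2, 0, 2}. w y) = 2 + 2 ^ k"
    by (simp add: w)
  finally show ?thesis .
qed

section \<open>Sharp energy bound\<close>

lemma powr_energy_exponent: "2 powr energy_exponent k = 2 + 2 ^ k"
  unfolding energy_exponent_def by (simp add: add_pos_pos)

lemma energy_exponent_ge: "real k \<le> energy_exponent k"
proof -
  have "2 powr real k \<le> 2 powr energy_exponent k"
    by (simp add: powr_energy_exponent powr_realpow)
  then show ?thesis by simp
qed

theorem corollary1p6:
  fixes k :: nat
  assumes "k \<ge> 2"
  shows "(\<forall>A B :: (int ^ 'd) set. A \<subseteq> sign_cube \<longrightarrow> B \<subseteq> sign_cube \<longrightarrow>
            real (higher_energy k A B)
              \<le> real (card A) powr (energy_exponent k / 2) * real (card B) powr (energy_exponent k / 2))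
       \<and> (\<forall>q::real. q < energy_exponent k \<longrightarrow>
            (\<exists>A B :: (int ^ 'd) set. A \<subseteq> sign_cube \<and> B \<subseteq> sign_cube \<and>
               real (higher_energy k A B) > real (card A) powr (q / 2) * real (card B) powr (q / 2)))"
proof (intro conjI allI impI)
  fix A B :: "(int ^ 'd) set"
  assume AB: "A \<subseteq> sign_cube" "B \<subseteq> sign_cube"
  \<comment> \<open>The hypothesis \<open>t \<ge> 1\<close> of the two-point inequality amounts to \<open>2\<^sup>k \<le> 2 + 2\<^sup>k\<close>.\<close>
  define t where "t = energy_exponent k / k"
  have t: "t * k = energy_exponent k" "1 \<le> t"
    using assms energy_exponent_ge[of k] by (auto simp: t_def)
  have "real (higher_energy k A B) = (\<Sum>x\<in>diff_cube. real (diff_count A B x) ^ k)"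
    using assms AB by (simp add: higher_energy_eq_sum)
  also have "\<dots> \<le> real (card A) powr (t * k / 2) * real (card B) powr (t * k / 2)"
    by (rule sum_diff_count_le[where I = UNIV])
      (use assms t AB powr_energy_exponent in auto)
  finally show "real (higher_energy k A B)
      \<le> real (card A) powr (energy_exponent k / 2) * real (card B) powr (energy_exponent k / 2)"
    unfolding t .
next
  fix q :: real assume q: "q < energy_exponent k"
  let ?Q = "sign_cube :: (int ^ 'd) set"
  have "real (card ?Q) powr (q / 2) * real (card ?Q) powr (q / 2) = (2 ^ CARD('d)) powr q"
    by (simp add: card_sign_cube flip: powr_add)
  also have "\<dots> < (2 ^ CARD('d)) powr energy_exponent k"
    using q by (intro powr_less_mono) auto
  also have "(2 ^ CARD('d)) powr energy_exponent k = (2 powr real CARD('d)) powr energy_exponent k"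
    by (simp add: powr_realpow)
  also have "\<dots> = (2 powr energy_exponent k) ^ CARD('d)"
    by (simp only: powr_powr powr_power_real[OF zero_less_card_finite] mult.commute)
  also have "\<dots> = real (higher_energy k ?Q ?Q)"
    using assms by (simp add: higher_energy_sign_cube powr_energy_exponent)
  finally show "\<exists>A B :: (int ^ 'd) set. A \<subseteq> sign_cube \<and> B \<subseteq> sign_cube \<and>
      real (card A) powr (q / 2) * real (card B) powr (q / 2) < real (higher_energy k A B)"
    by blast
qed

end
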